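(* Let $P$ be a bounded, ranked poset of length $n$. Then for all $t\in\mathbb P$, \[\sum_{j=1}^n\mu\big(\widehat{I_{j-1}(P)}\big)\,t^j=-\mu\big((P^\ast\ast T_{t,n})^+\big),\] where $P^\ast$ is the dual of $P$.
   Context: $P^-=P\setminus\{\hat0_P\}$; $C_n$ is the chain $0<\dots<n-1$; $I_j(P)$ is the open principal lower order ideal $\{z\in P^-\ast C_n: z<(\hat1_P,j)\}$. For ranked $P,Q$ the Rees product is $P\ast Q=\{(p,q): r_P(p)\ge r_Q(q)\}$ with $(p_1,q_1)\le(p_2,q_2)$ iff $p_1\le p_2$, $q_1\le q_2$, $r_P(p_2)-r_P(p_1)\ge r_Q(q_2)-r_Q(q_1)$. $T_{t,n}$ is the poset whose Hasse diagram is a complete $t$-ary rooted tree of height $n$ with root at the bottom (every non-leaf has $t$ children, all leaves at distance $n$). $\widehat X$ is $X$ with a new minimum and new maximum adjoined; $X^+$ is $X$ with a new maximum adjoined. For a bounded poset $B$, $\mu(B)=\mu_B(\hat0_B,\hat1_B)$ (Möbius function).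
   Formalization: The length n of P is assumed to be at least 1: for the one-element poset (n = 0) the sum is empty, hence 0, while the right-hand side equals 1, so the identity fails there. All posets are taken to be finite. *)

theory Defs
  imports Main "HOL-Library.Sublist"
begin

text \<open>
  A poset is a reflexive, antisymmetric, transitive relation \<open>r\<close> (\<open>Partial_order r\<close>); its
  underlying set is \<open>Field r\<close>, its dual is the converse \<open>r\<inverse>\<close>, and the subposet induced on \<open>A\<close>
  is \<open>Restr r A\<close>.  The empty poset is the empty relation.
\<close>

definition is_minimum :: "'a rel \<Rightarrow> 'a \<Rightarrow> bool" where
  "is_minimum r a \<longleftrightarrow> a \<in> Field r \<and> (\<forall>x\<in>Field r. (a, x) \<in> r)"

definition is_maximum :: "'a rel \<Rightarrow> 'a \<Rightarrow> bool" where
  "is_maximum r b \<longleftrightarrow> b \<in> Field r \<and> (\<forall>x\<in>Field r. (x, b) \<in> r)"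

definition bounded_poset :: "'a rel \<Rightarrow> bool" where
  "bounded_poset r \<longleftrightarrow> Partial_order r \<and> (\<exists>a. is_minimum r a) \<and> (\<exists>b. is_maximum r b)"

definition zero_hat :: "'a rel \<Rightarrow> 'a" where
  "zero_hat r = (THE a. is_minimum r a)"

definition one_hat :: "'a rel \<Rightarrow> 'a" where
  "one_hat r = (THE b. is_maximum r b)"

definition ranked :: "'a rel \<Rightarrow> bool" where
  "ranked r \<longleftrightarrow> (\<forall>C D. pred_on.maxchain (Field r) (\<lambda>x y. (x, y) \<in> r) C \<longrightarrow>
     pred_on.maxchain (Field r) (\<lambda>x y. (x, y) \<in> r) D \<longrightarrow> card C = card D)"

text \<open>A chain with \<open>k + 1\<close> elements has length \<open>k\<close>; only used for finite nonempty posets.\<close>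

definition poset_length :: "'a rel \<Rightarrow> nat" where
  "poset_length r = Max (card ` Chains r) - 1"

definition poset_rank :: "'a rel \<Rightarrow> 'a \<Rightarrow> nat" where
  "poset_rank r x = poset_length (Restr r (under r x))"

definition rees_product :: "'a rel \<Rightarrow> 'b rel \<Rightarrow> ('a \<times> 'b) rel" where
  "rees_product P Q =
     {((p1, q1), (p2, q2)).
        poset_rank P p1 \<ge> poset_rank Q q1 \<and> poset_rank P p2 \<ge> poset_rank Q q2 \<and>
        (p1, p2) \<in> P \<and> (q1, q2) \<in> Q \<and>
        int (poset_rank P p2) - int (poset_rank P p1) \<ge>
          int (poset_rank Q q2) - int (poset_rank Q q1)}"

definition remove_zero :: "'a rel \<Rightarrow> 'a rel" where
  "remove_zero P = Restr P (Field P - {zero_hat P})"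

definition chain_poset :: "nat \<Rightarrow> nat rel" where
  "chain_poset n = {(i, j). i \<le> j \<and> j < n}"

definition lower_ideal :: "'a rel \<Rightarrow> nat \<Rightarrow> ('a \<times> nat) rel" where
  "lower_ideal P j =
     (let R = rees_product (remove_zero P) (chain_poset (poset_length P))
      in Restr R (underS R (one_hat P, j)))"

text \<open>
  The nodes of the complete \<open>t\<close>-ary tree of height \<open>n\<close> are the words of length at most \<open>n\<close> over
  the alphabet \<open>{0..<t}\<close>, ordered by prefix: the root is the empty word, the children of a word
  of length less than \<open>n\<close> are its \<open>t\<close> one-letter extensions, and the leaves are the words of
  length \<open>n\<close>.
\<close>

definition tree_poset :: "nat \<Rightarrow> nat \<Rightarrow> nat list rel" where
  "tree_poset t n = {(u, v). prefix u v \<and> length v \<le> n \<and> set v \<subseteq> {..<t}}"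

definition add_max :: "'a rel \<Rightarrow> 'a option rel" where
  "add_max X = map_prod Some Some ` X \<union> insert None (Some ` Field X) \<times> {None}"

definition add_min :: "'a rel \<Rightarrow> 'a option rel" where
  "add_min X = map_prod Some Some ` X \<union> {None} \<times> insert None (Some ` Field X)"

definition hat :: "'a rel \<Rightarrow> 'a option option rel" where
  "hat X = add_max (add_min X)"

text \<open>
  The guard only serves termination; on finite posets this is the usual recursion
  \<open>\<mu>(x, x) = 1\<close> and \<open>\<mu>(x, y) = - (\<Sum>z | x \<le> z < y. \<mu>(x, z))\<close> for \<open>x < y\<close>.
\<close>

function mobius :: "'a rel \<Rightarrow> 'a \<Rightarrow> 'a \<Rightarrow> int" where
  "mobius r x y =
     (if finite r \<and> Partial_order r \<and> (x, y) \<in> r then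
        if x = y then 1
        else - (\<Sum>z\<in>{z. (x, z) \<in> r \<and> (z, y) \<in> r \<and> z \<noteq> y}. mobius r x z)
      else 0)"
  by pat_completeness auto
termination
proof (relation "measure (\<lambda>(r, x, y). card (under r y))", goal_cases)
  case (2 r x y z)
  then have po: "finite r" "trans r" "antisym r" "refl_on (Field r) r"
    by (auto simp: partial_order_on_def preorder_on_def)
  have zy: "(z, y) \<in> r" "z \<noteq> y" using 2 by auto
  have "under r z \<subseteq> under r y"
    using po zy by (auto simp: under_def elim: transE)
  moreover have "y \<notin> under r z"
    using po zy by (auto simp: under_def dest: antisymD)
  moreover have "y \<in> under r y"
    using po zy by (auto simp: under_def Field_def refl_on_def)
  moreover have "finite (under r y)"
    using po by (auto simp: under_def intro!: rev_image_eqI intro: finite_subset[OF _ finite_imageI[of r fst]])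
  ultimately show ?case by (auto intro: psubset_card_mono)
qed simp

declare mobius.simps [simp del]

definition mobius_number :: "'a rel \<Rightarrow> int" where
  "mobius_number B = mobius B (zero_hat B) (one_hat B)"

end

(*
  Let F(p, m) be the Moebius function from (1, 0) to (p, m) in the Rees product of the dual of P
  with a chain.  An interval from (1, root) to (p, u) in the Rees product of the dual with the tree
  only sees the prefixes of u, so its Moebius function is F(p, |u|), and the right-hand side is
  the sum of t^m F(p, m) over all p and m with m + r(p) <= n.  An interval from (p, i) to (1, j) in
  the Rees product of P^- with the chain is dual to the one below (p, j - i), so the coefficients on
  the left-hand side are also sums of values of F.  For each j, the two coefficients of t^j agree
  because F sums to 0 over the interval from (1, 0) to (0, j).
*)
theory Submission
  imports Defs
begin

section \<open>Partial orders as relations, and their least and greatest elements\<close>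

lemma Partial_orderD:
  assumes "Partial_order r"
  shows "x \<in> Field r \<Longrightarrow> (x, x) \<in> r"
    and "(x, y) \<in> r \<Longrightarrow> (y, z) \<in> r \<Longrightarrow> (x, z) \<in> r"
    and "(x, y) \<in> r \<Longrightarrow> (y, x) \<in> r \<Longrightarrow> x = y"
  using assms
  by (auto simp: partial_order_on_def preorder_on_def refl_on_def elim: transE dest: antisymD)

lemma Partial_orderI:
  assumes "\<And>x y. (x, y) \<in> r \<Longrightarrow> (x, x) \<in> r \<and> (y, y) \<in> r"
    and "\<And>x y z. (x, y) \<in> r \<Longrightarrow> (y, z) \<in> r \<Longrightarrow> (x, z) \<in> r"
    and "\<And>x y. (x, y) \<in> r \<Longrightarrow> (y, x) \<in> r \<Longrightarrow> x = y"
  shows "Partial_order r"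
  unfolding partial_order_on_def preorder_on_def
proof (intro conjI)
  show "refl_on (Field r) r" using assms(1) by (auto simp: refl_on_def Field_def)
  show "trans r" using assms(2) by (blast intro: transI)
  show "antisym r" using assms(3) by (blast intro: antisymI)
qed (auto simp: Field_def)

lemma Partial_order_Restr: "Partial_order r \<Longrightarrow> Partial_order (Restr r A)"
  by (rule Partial_orderI)
    (auto intro: Partial_orderD simp: FieldI1 FieldI2)

lemma Field_Restr_Partial_order: "Partial_order r \<Longrightarrow> Field (Restr r A) = Field r \<inter> A"
proof
  assume "Partial_order r"
  then show "Field r \<inter> A \<subseteq> Field (Restr r A)"
    using Partial_orderD(1) by (auto intro!: FieldI1)
qed (auto simp: Field_def)

lemma finite_Field_iff: "finite (Field r) \<longleftrightarrow> finite r"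
proof
  assume "finite (Field r)"
  moreover have "r \<subseteq> Field r \<times> Field r" by (auto simp: Field_def)
  ultimately show "finite r" by (meson finite_SigmaI finite_subset)
qed (rule finite_Field)

lemma zero_hat_eqI: "Partial_order r \<Longrightarrow> is_minimum r a \<Longrightarrow> zero_hat r = a"
  unfolding zero_hat_def is_minimum_def by (blast intro: the_equality Partial_orderD(3))

lemma one_hat_eqI: "Partial_order r \<Longrightarrow> is_maximum r a \<Longrightarrow> one_hat r = a"
  unfolding one_hat_def is_maximum_def by (blast intro: the_equality Partial_orderD(3))

section \<open>Adjoining a new maximum or minimum\<close>

lemma add_max_simps [simp]:
  "(Some x, Some y) \<in> add_max X \<longleftrightarrow> (x, y) \<in> X"
  "(Some x, None) \<in> add_max X \<longleftrightarrow> x \<in> Field X"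
  "(None, None) \<in> add_max X"
  "(None, Some y) \<notin> add_max X"
  by (auto simp: add_max_def)

lemma add_min_simps [simp]:
  "(Some x, Some y) \<in> add_min X \<longleftrightarrow> (x, y) \<in> X"
  "(None, Some x) \<in> add_min X \<longleftrightarrow> x \<in> Field X"
  "(None, None) \<in> add_min X"
  "(Some y, None) \<notin> add_min X"
  by (auto simp: add_min_def)

lemma Field_add_max [simp]: "Field (add_max X) = insert None (Some ` Field X)"
  by (auto simp: add_max_def Field_def)

lemma Field_add_min [simp]: "Field (add_min X) = insert None (Some ` Field X)"
  by (auto simp: add_min_def Field_def)

lemma Partial_order_add_max:
  assumes "Partial_order X"
  shows "Partial_order (add_max X)"
proof (rule Partial_orderI)
  note PO = Partial_orderD[OF assms]
  fix x y z
  show "(x, x) \<in> add_max X \<and> (y, y) \<in> add_max X" if "(x, y) \<in> add_max X"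
    using that by (cases x; cases y) (auto intro: PO FieldI1 FieldI2)
  show "(x, z) \<in> add_max X" if "(x, y) \<in> add_max X" "(y, z) \<in> add_max X"
    using that by (cases x; cases y; cases z) (auto intro: PO FieldI1 FieldI2)
  show "x = y" if "(x, y) \<in> add_max X" "(y, x) \<in> add_max X"
    using that by (cases x; cases y) (auto intro: PO FieldI1 FieldI2)
qed

lemma Partial_order_add_min:
  assumes "Partial_order X"
  shows "Partial_order (add_min X)"
proof (rule Partial_orderI)
  note PO = Partial_orderD[OF assms]
  fix x y z
  show "(x, x) \<in> add_min X \<and> (y, y) \<in> add_min X" if "(x, y) \<in> add_min X"
    using that by (cases x; cases y) (auto intro: PO FieldI1 FieldI2)
  show "(x, z) \<in> add_min X" if "(x, y) \<in> add_min X" "(y, z) \<in> add_min X"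
    using that by (cases x; cases y; cases z) (auto intro: PO FieldI1 FieldI2)
  show "x = y" if "(x, y) \<in> add_min X" "(y, x) \<in> add_min X"
    using that by (cases x; cases y) (auto intro: PO FieldI1 FieldI2)
qed

lemma is_maximum_add_max: "is_maximum (add_max X) None"
  by (auto simp: is_maximum_def)

lemma is_minimum_hat: "is_minimum (hat X) (Some None)"
  by (auto simp: is_minimum_def hat_def)

lemma Partial_order_hat: "Partial_order X \<Longrightarrow> Partial_order (hat X)"
  unfolding hat_def by (intro Partial_order_add_max Partial_order_add_min)

lemma finite_add_max: "finite X \<Longrightarrow> finite (add_max X)"
  by (simp add: add_max_def finite_Field)

lemma finite_hat: "finite X \<Longrightarrow> finite (hat X)"
  by (simp add: hat_def finite_add_max add_min_def finite_Field)

section \<open>The Moebius function\<close>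

definition interval :: "'a rel \<Rightarrow> 'a \<Rightarrow> 'a \<Rightarrow> 'a set" where
  "interval r x y = {z. (x, z) \<in> r \<and> (z, y) \<in> r}"

lemma interval_add_max_Some: "interval (add_max X) (Some x) (Some y) = Some ` interval X x y"
proof (rule set_eqI)
  show "z \<in> interval (add_max X) (Some x) (Some y) \<longleftrightarrow> z \<in> Some ` interval X x y" for z
    by (cases z) (auto simp: interval_def)
qed

lemma interval_add_max_None:
  assumes "x \<in> Field X"
  shows "interval (add_max X) (Some x) None = insert None (Some ` {y. (x, y) \<in> X})"
proof (rule set_eqI)
  show "z \<in> interval (add_max X) (Some x) None \<longleftrightarrow> z \<in> insert None (Some ` {y. (x, y) \<in> X})" for z
    using assms by (cases z) (auto simp: interval_def intro: FieldI2)
qed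

lemma interval_hat_top: "interval (hat X) None None = {None}"
proof (rule set_eqI)
  show "z \<in> interval (hat X) None None \<longleftrightarrow> z \<in> {None}" for z
    by (cases z) (auto simp: interval_def hat_def)
qed

lemma interval_hat_Some:
  assumes "x \<in> Field X"
  shows "interval (hat X) (Some (Some x)) None = insert None (Some ` Some ` {y. (x, y) \<in> X})"
proof -
  have "{y. (Some x, y) \<in> add_min X} = Some ` {y. (x, y) \<in> X}"
  proof (rule set_eqI)
    show "z \<in> {y. (Some x, y) \<in> add_min X} \<longleftrightarrow> z \<in> Some ` {y. (x, y) \<in> X}" for z
      by (cases z) auto
  qed
  then show ?thesis using assms by (simp add: hat_def interval_add_max_None)
qed

lemma finite_interval: "finite r \<Longrightarrow> finite (interval r x y)"
  by (rule finite_subset[OF _ finite_Field[of r]]) (auto simp: interval_def Field_def)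

text \<open>The recursion with \<open>mobius r x y\<close> moved to the side of the sum. Sums over
  closed intervals carry over along bijections, which is how Moebius functions of different posets
  are compared below.\<close>

lemma sum_mobius_interval:
  assumes "finite r" "Partial_order r" "(x, y) \<in> r"
  shows "(\<Sum>z\<in>interval r x y. mobius r x z) = (if x = y then 1 else 0)"
proof -
  note PO = Partial_orderD[OF assms(2)]
  have yy: "(x, x) \<in> r" "(y, y) \<in> r" using assms(3) PO(1) by (auto intro: FieldI1 FieldI2)
  show ?thesis
  proof (cases "x = y")
    case True
    then have "interval r x y = {x}" using PO(3) yy by (auto simp: interval_def)
    then show ?thesis using True assms by (simp add: mobius.simps)
  next
    case False
    define A where "A = {z. (x, z) \<in> r \<and> (z, y) \<in> r \<and> z \<noteq> y}"
    have "interval r x y = insert y A" using assms yy by (auto simp: interval_def A_def)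
    moreover have "finite A" "y \<notin> A"
      using finite_interval[OF assms(1), of x y] calculation by (auto simp: A_def)
    moreover have "mobius r x y = - sum (mobius r x) A"
      unfolding A_def by (subst mobius.simps) (use assms False in simp)
    ultimately show ?thesis using False by simp
  qed
qed

text \<open>The interval sums determine the values successively, by induction on the number of
  elements below \<open>y\<close>.\<close>

lemma mobius_unique_left:
  assumes r: "finite r" "Partial_order r"
    and g: "\<And>y. (x, y) \<in> r \<Longrightarrow> (\<Sum>z\<in>interval r x y. g z) = (if x = y then 1 else 0)"
    and "(x, y) \<in> r"
  shows "mobius r x y = g y"
  using assms(4)
proof (induction "card (under r y)" arbitrary: y rule: less_induct)
  case less
  note PO = Partial_orderD[OF r(2)]
  define A where "A = interval r x y - {y}"
  have yy: "(y, y) \<in> r" using less.prems PO(1) by (auto intro: FieldI2)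
  then have int: "interval r x y = insert y A" using less.prems by (auto simp: interval_def A_def)
  have A: "finite A" "y \<notin> A" using finite_interval[OF r(1)] by (auto simp: A_def)
  have "mobius r x z = g z" if "z \<in> A" for z
  proof (rule less.hyps)
    have z: "(z, y) \<in> r" "z \<noteq> y" "(x, z) \<in> r" using that by (auto simp: A_def interval_def)
    show "(x, z) \<in> r" by fact
    have "under r z \<subseteq> under r y" using z PO(2) by (auto simp: under_def)
    moreover have "y \<in> under r y" "y \<notin> under r z" using z yy PO(3) by (auto simp: under_def)
    moreover have "finite (under r y)"
      by (rule finite_subset[OF _ finite_Field[OF r(1)]]) (auto simp: under_def Field_def)
    ultimately show "card (under r z) < card (under r y)" by (intro psubset_card_mono) auto
  qed
  then have "sum (mobius r x) A = sum g A" by (rule sum.cong[OF refl])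
  then show ?case
    using g[OF less.prems] sum_mobius_interval[OF r less.prems] A by (simp add: int)
qed

text \<open>The double sum of \<open>mobius r x w * g z\<close> over \<open>x \<le> w \<le> z \<le> y\<close>, evaluated in both orders.\<close>

lemma mobius_unique_right:
  assumes r: "finite r" "Partial_order r"
    and g: "\<And>x. (x, y) \<in> r \<Longrightarrow> (\<Sum>z\<in>interval r x y. g z) = (if x = y then 1 else 0)"
    and xy: "(x, y) \<in> r"
  shows "mobius r x y = g x"
proof -
  note PO = Partial_orderD[OF r(2)]
  let ?I = "interval r x y"
  have fin: "finite ?I" by (rule finite_interval[OF r(1)])
  have xI: "x \<in> ?I" "y \<in> ?I" using xy PO(1) by (auto simp: interval_def intro: FieldI1 FieldI2)
  \<comment> \<open>The factor selecting \<open>w = y\<close> is the interval sum of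
    \<open>g\<close> from \<open>w\<close> up to \<open>y\<close>; replacing it creates the double
    sum.\<close>
  have "mobius r x y = (\<Sum>w\<in>?I. mobius r x w * (if w = y then 1 else 0))"
    using fin xI by (simp add: if_distrib sum.delta cong: if_cong)
  also have "\<dots> = (\<Sum>w\<in>?I. mobius r x w * (\<Sum>z\<in>interval r w y. g z))"
    by (intro sum.cong refl arg_cong2[where f = "(*)"]) (simp add: g interval_def[of r x])
  also have "\<dots> = (\<Sum>w\<in>?I. \<Sum>z\<in>{z\<in>?I. (w, z) \<in> r}. mobius r x w * g z)"
    unfolding sum_distrib_left
    by (intro sum.cong refl) (auto simp: interval_def intro: PO(2))
  also have "\<dots> = (\<Sum>z\<in>?I. \<Sum>w\<in>{w\<in>?I. (w, z) \<in> r}. mobius r x w * g z)"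
    by (rule sum.swap_restrict[OF fin fin])
  also have "\<dots> = (\<Sum>z\<in>?I. (\<Sum>w\<in>interval r x z. mobius r x w) * g z)"
    unfolding sum_distrib_right
    by (intro sum.cong refl) (auto simp: interval_def intro: PO(2))
  also have "\<dots> = (\<Sum>z\<in>?I. (if x = z then 1 else 0) * g z)"
    by (intro sum.cong refl arg_cong2[where f = "(*)"])
      (simp add: sum_mobius_interval[OF r] interval_def[of r x y])
  also have "\<dots> = g x" using fin xI by (simp add: if_distrib if_distribR sum.delta' cong: if_cong)
  finally show ?thesis .
qed

section \<open>Ranks\<close>

lemma finite_Chains: "finite r \<Longrightarrow> finite (Chains r)"
  by (rule finite_subset[of _ "Pow (Field r)"]) (auto simp: Chains_def finite_Field intro: FieldI1)

lemma finite_chain: "finite r \<Longrightarrow> C \<in> Chains r \<Longrightarrow> finite C"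
  by (rule finite_subset[of _ "Field r"]) (auto simp: Chains_def finite_Field intro: FieldI1)

lemma poset_length_eqI:
  assumes "finite r" "C \<in> Chains r" "card C = Suc k" "\<And>D. D \<in> Chains r \<Longrightarrow> card D \<le> Suc k"
  shows "poset_length r = k"
proof -
  have "Max (card ` Chains r) = Suc k"
    by (rule Max_eqI) (use assms finite_Chains in \<open>auto intro: rev_image_eqI\<close>)
  then show ?thesis by (simp add: poset_length_def)
qed

lemma ex_longest_chain:
  assumes "finite r" "r \<noteq> {}" "Partial_order r"
  obtains C where "C \<in> Chains r" "card C = Suc (poset_length r)"
    "\<And>D. D \<in> Chains r \<Longrightarrow> card D \<le> card C"
proof -
  let ?M = "Max (card ` Chains r)"
  have fin: "finite (card ` Chains r)" using finite_Chains[OF assms(1)] by simp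
  have "{} \<in> Chains r" by (simp add: Chains_def)
  then have "?M \<in> card ` Chains r" using fin by (intro Max_in) auto
  then obtain C where C: "C \<in> Chains r" "card C = ?M" by auto
  \<comment> \<open>A one-element chain shows that the maximum is at least 1, so the subtraction in
    \<open>poset_length\<close> is not truncated.\<close>
  obtain x y where "(x, y) \<in> r" using assms(2) by auto
  then have "{x} \<in> Chains r" using Partial_orderD(1)[OF assms(3)]
    by (auto simp: Chains_def intro: FieldI1)
  then have "1 \<le> ?M" using fin by (intro Max_ge) (auto intro: rev_image_eqI)
  then have "card C = Suc (poset_length r)" using C by (simp add: poset_length_def)
  with C fin show ?thesis by (intro that) auto
qed

text \<open>When the elements below \<open>x\<close> are pairwise comparable, they form a chain
  containing every other chain below \<open>x\<close>. This yields the ranks in chains and trees and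
  the rank of the minimum.\<close>

lemma poset_rank_chain:
  assumes "finite r" "\<And>y z. y \<in> under r x \<Longrightarrow> z \<in> under r x \<Longrightarrow> (y, z) \<in> r \<or> (z, y) \<in> r"
    and "card (under r x) = Suc k"
  shows "poset_rank r x = k"
  unfolding poset_rank_def
proof (rule poset_length_eqI)
  have fin: "finite (under r x)" using assms(3) card.infinite by fastforce
  show "under r x \<in> Chains (Restr r (under r x))" using assms(2) by (auto simp: Chains_def)
  show "card D \<le> Suc k" if "D \<in> Chains (Restr r (under r x))" for D
    unfolding assms(3)[symmetric] using that by (intro card_mono fin) (auto simp: Chains_def)
qed (use assms in auto)

lemma poset_rank_chain_poset:
  assumes "j < n"
  shows "poset_rank (chain_poset n) j = j"
proof (rule poset_rank_chain)
  have "chain_poset n \<subseteq> {..<n} \<times> {..<n}" by (auto simp: chain_poset_def)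
  then show "finite (chain_poset n)" by (rule finite_subset) simp
  have "under (chain_poset n) j = {..j}" using assms by (auto simp: under_def chain_poset_def)
  then show "card (under (chain_poset n) j) = Suc j" by simp
qed (auto simp: under_def chain_poset_def)

lemma finite_tree_poset: "finite (tree_poset t n)"
proof -
  let ?L = "{u. set u \<subseteq> {..<t} \<and> length u \<le> n}"
  have "tree_poset t n \<subseteq> ?L \<times> ?L"
    by (auto simp: tree_poset_def dest: set_mono_prefix prefix_length_le)
  then show ?thesis by (rule finite_subset) (simp add: finite_lists_length_le)
qed

lemma Partial_order_tree_poset: "Partial_order (tree_poset t n)"
  by (rule Partial_orderI)
    (auto simp: tree_poset_def dest: set_mono_prefix prefix_length_le)

lemma poset_rank_tree_poset:
  assumes "set u \<subseteq> {..<t}" "length u \<le> n"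
  shows "poset_rank (tree_poset t n) u = length u"
proof (rule poset_rank_chain)
  have "under (tree_poset t n) u = set (prefixes u)"
    using assms by (auto simp: under_def tree_poset_def)
  then show "card (under (tree_poset t n) u) = Suc (length u)"
    by (simp add: distinct_card)
  show "(y, z) \<in> tree_poset t n \<or> (z, y) \<in> tree_poset t n"
    if "y \<in> under (tree_poset t n) u" "z \<in> under (tree_poset t n) u" for y z
    using that prefix_same_cases[of y u z]
    by (auto simp: under_def tree_poset_def dest: set_mono_prefix prefix_length_le)
qed (rule finite_tree_poset)

lemma Partial_order_rees_product:
  assumes "Partial_order P" "Partial_order Q"
  shows "Partial_order (rees_product P Q)"
  by (rule Partial_orderI)
    (auto simp: rees_product_def intro: assms[THEN Partial_orderD(1)]
       assms[THEN Partial_orderD(2)] assms[THEN Partial_orderD(3)] FieldI1 FieldI2)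

lemma finite_rees_product:
  assumes "finite P" "finite Q"
  shows "finite (rees_product P Q)"
proof -
  have "rees_product P Q \<subseteq> (Field P \<times> Field Q) \<times> (Field P \<times> Field Q)"
    by (auto simp: rees_product_def Field_def)
  then show ?thesis by (rule finite_subset) (simp add: assms finite_Field)
qed

lemma Partial_order_chain_poset: "Partial_order (chain_poset n)"
  by (rule Partial_orderI) (auto simp: chain_poset_def)

locale finite_ranked_poset =
  fixes P :: "'a rel"
  assumes finite_P: "finite P"
    and bounded: "bounded_poset P"
    and ranked: "ranked P"
begin

abbreviation bottom ("\<zero>") where "\<zero> \<equiv> zero_hat P"
abbreviation topmost ("\<one>") where "\<one> \<equiv> one_hat P"
abbreviation n where "n \<equiv> poset_length P"
abbreviation rk where "rk \<equiv> poset_rank P"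

lemma PO: "Partial_order P"
  using bounded by (simp add: bounded_poset_def)

lemmas refl_P = Partial_orderD(1)[OF PO]
lemmas trans_P = Partial_orderD(2)[OF PO]
lemmas antisym_P = Partial_orderD(3)[OF PO]

lemma bottom_le: "x \<in> Field P \<Longrightarrow> (\<zero>, x) \<in> P"
  using bounded zero_hat_eqI[OF PO] by (auto simp: bounded_poset_def is_minimum_def)

lemma le_top: "x \<in> Field P \<Longrightarrow> (x, \<one>) \<in> P"
  using bounded one_hat_eqI[OF PO] by (auto simp: bounded_poset_def is_maximum_def)

lemma bottom_in: "\<zero> \<in> Field P" and top_in: "\<one> \<in> Field P"
  using bounded zero_hat_eqI[OF PO] one_hat_eqI[OF PO]
  by (auto simp: bounded_poset_def is_minimum_def is_maximum_def)

text \<open>Longest chains below and above \<open>p\<close> combine to a maximal chain, whose size is known by rankedness.\<close>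

lemma rank_dual:
  assumes "p \<in> Field P"
  shows "poset_rank (P\<inverse>) p + rk p = n"
proof -
  let ?L = "Restr P (under P p)" and ?U = "Restr (P\<inverse>) (under (P\<inverse>) p)"
  have pp: "(p, p) \<in> P" using assms refl_P by simp
  have POc: "Partial_order (P\<inverse>)" using PO by simp
  have L: "finite ?L" "?L \<noteq> {}" "Partial_order ?L"
    using finite_P pp PO Partial_order_Restr by (auto simp: under_def)
  have U: "finite ?U" "?U \<noteq> {}" "Partial_order ?U"
    using finite_P pp Partial_order_Restr[OF POc] by (auto simp: under_def)
  obtain C where C: "C \<in> Chains ?L" "card C = Suc (rk p)"
    "\<And>X. X \<in> Chains ?L \<Longrightarrow> card X \<le> card C"
    using ex_longest_chain[OF L] by (metis poset_rank_def)
  obtain D where D: "D \<in> Chains ?U" "card D = Suc (poset_rank (P\<inverse>) p)"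
    "\<And>X. X \<in> Chains ?U \<Longrightarrow> card X \<le> card D"
    using ex_longest_chain[OF U] by (metis poset_rank_def)
  obtain E where E: "E \<in> Chains P" "card E = Suc n"
    "\<And>X. X \<in> Chains P \<Longrightarrow> card X \<le> card E"
    using ex_longest_chain[OF finite_P _ PO] pp by blast
  have Cp: "(x, p) \<in> P" if "x \<in> C" for x using C(1) that by (auto simp: Chains_def under_def)
  have Dp: "(p, x) \<in> P" if "x \<in> D" for x using D(1) that by (auto simp: Chains_def under_def)
  have fC: "finite C" and fD: "finite D"
    using C(1) D(1) L U finite_chain by blast+
  have "insert p C \<in> Chains ?L" using C(1) pp by (auto simp: Chains_def under_def)
  \<comment> \<open>The chain \<open>C\<close> has the largest size below \<open>p\<close>, so
    inserting \<open>p\<close> cannot enlarge it.\<close>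
  then have pC: "p \<in> C" using C(3)[of "insert p C"] fC by (auto simp: card_insert_if split: if_splits)
  have "insert p D \<in> Chains ?U" using D(1) pp by (auto simp: Chains_def under_def)
  then have pD: "p \<in> D" using D(3)[of "insert p D"] fD by (auto simp: card_insert_if split: if_splits)
  have CD: "C \<inter> D = {p}" using Cp Dp antisym_P pC pD by auto
  have chain_iff: "pred_on.chain (Field P) (\<lambda>x y. (x, y) \<in> P) X \<longleftrightarrow> X \<in> Chains P" for X
    unfolding pred_on.chain_def Chains_def using refl_P by (simp, blast intro: FieldI1)
  have CDch: "C \<union> D \<in> Chains P"
  proof -
    have "(x, y) \<in> P" if "x \<in> C" "y \<in> D" for x y using trans_P Cp Dp that by blast
    then show ?thesis using C(1) D(1) by (auto simp: Chains_def)
  qed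
  \<comment> \<open>An element comparable with all of \<open>C \<union> D\<close> is comparable with
    \<open>p\<close>, so if new it would extend \<open>C\<close> below \<open>p\<close> or
    \<open>D\<close> above \<open>p\<close>, against their choice as longest chains.\<close>
  have max1: "pred_on.maxchain (Field P) (\<lambda>x y. (x, y) \<in> P) (C \<union> D)"
    unfolding pred_on.maxchain_def chain_iff
  proof (intro conjI CDch notI, elim exE conjE)
    fix X assume X: "X \<in> Chains P" "C \<union> D \<subset> X"
    then obtain x where x: "x \<in> X" "x \<notin> C" "x \<notin> D" by auto
    have comp: "(x, y) \<in> P \<or> (y, x) \<in> P" if "y \<in> X" for y
      using X that x by (auto simp: Chains_def)
    have xx: "(x, x) \<in> P" using comp x by auto
    consider "(x, p) \<in> P" | "(p, x) \<in> P" using comp[of p] pC X by auto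
    then show False
    proof cases
      case 1
      then have "insert x C \<in> Chains ?L"
        using C(1) comp X(2) xx by (auto simp: Chains_def under_def)
      then show False using C(3)[of "insert x C"] fC x by (auto simp: card_insert_if split: if_splits)
    next
      case 2
      then have "insert x D \<in> Chains ?U"
        using D(1) comp X(2) xx by (auto simp: Chains_def under_def)
      then show False using D(3)[of "insert x D"] fD x by (auto simp: card_insert_if split: if_splits)
    qed
  qed
  \<comment> \<open>A chain of largest size is maximal, so rankedness equates the sizes of
    \<open>E\<close> and \<open>C \<union> D\<close>.\<close>
  have max2: "pred_on.maxchain (Field P) (\<lambda>x y. (x, y) \<in> P) E"
    unfolding pred_on.maxchain_def chain_iff
    using E finite_chain[OF finite_P] by (metis leD psubset_card_mono)
  have "card (C \<union> D) = Suc n" using ranked max1 max2 E(2) unfolding ranked_def by metis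
  \<comment> \<open>Only \<open>p\<close> is shared, so the sizes of \<open>C\<close> and
    \<open>D\<close>, each one more than a rank, add up to \<open>n + 2\<close>.\<close>
  moreover have "card (C \<union> D) + card (C \<inter> D) = card C + card D"
    using card_Un_Int[OF fC fD] by simp
  ultimately show ?thesis using C(2) D(2) CD by simp
qed

lemma rank_top: "rk \<one> = n"
proof -
  have "Restr P (under P \<one>) = P" using le_top by (auto simp: under_def intro: FieldI1 FieldI2)
  then show ?thesis by (simp add: poset_rank_def)
qed

lemma rank_bottom: "rk \<zero> = 0"
proof (rule poset_rank_chain)
  have "under P \<zero> = {\<zero>}"
    using bottom_le antisym_P bottom_in by (auto simp: under_def intro: FieldI1)
  then show "card (under P \<zero>) = Suc 0"
    "\<And>y z. y \<in> under P \<zero> \<Longrightarrow> z \<in> under P \<zero> \<Longrightarrow> (y, z) \<in> P \<or> (z, y) \<in> P"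
    using bottom_le bottom_in by auto
qed (rule finite_P)

lemma remove_zero_iff: "(p, q) \<in> remove_zero P \<longleftrightarrow> (p, q) \<in> P \<and> p \<noteq> \<zero>"
  using bottom_le antisym_P by (auto simp: remove_zero_def intro: FieldI1 FieldI2)

text \<open>A longest chain below \<open>p\<close> loses exactly one element when
  \<open>\<zero>\<close> is removed.\<close>

lemma rank_remove_zero:
  assumes "p \<in> Field P" "p \<noteq> \<zero>"
  shows "Suc (poset_rank (remove_zero P) p) = rk p"
proof -
  let ?L = "Restr P (under P p)" and ?K = "Restr (remove_zero P) (under (remove_zero P) p)"
  have pp: "(p, p) \<in> P" using assms refl_P by simp
  have b: "(\<zero>, p) \<in> P" "(\<zero>, \<zero>) \<in> P" using assms bottom_le bottom_in by auto
  have L: "finite ?L" "?L \<noteq> {}" "Partial_order ?L"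
    using finite_P pp PO Partial_order_Restr by (auto simp: under_def)
  have POr: "Partial_order (remove_zero P)"
    unfolding remove_zero_def by (rule Partial_order_Restr[OF PO])
  have K: "finite ?K" "?K \<noteq> {}" "Partial_order ?K"
    using finite_P pp assms POr Partial_order_Restr
    by (auto simp: under_def remove_zero_iff remove_zero_def[of P])
  obtain C where C: "C \<in> Chains ?K" "card C = Suc (poset_rank (remove_zero P) p)"
    "\<And>X. X \<in> Chains ?K \<Longrightarrow> card X \<le> card C"
    using ex_longest_chain[OF K] by (metis poset_rank_def)
  \<comment> \<open>Here \<open>card C\<close> is already one more than the rank in
    \<open>remove_zero P\<close>. Adding \<open>\<zero>\<close> gives \<open>card C + 1\<close>
    elements, that is, length \<open>card C\<close>.\<close>
  have "poset_length ?L = card C"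
  proof (rule poset_length_eqI)
    have nz: "\<zero> \<notin> C" using C(1) by (auto simp: Chains_def remove_zero_iff)
    show "card (insert \<zero> C) = Suc (card C)"
      using nz finite_chain[OF K(1) C(1)] by simp
    show "insert \<zero> C \<in> Chains ?L"
      using C(1) b bottom_le by (auto simp: Chains_def under_def remove_zero_iff intro: FieldI1)
    fix D assume D: "D \<in> Chains ?L"
    have "D - {\<zero>} \<in> Chains ?K"
      using D by (auto simp: Chains_def under_def remove_zero_iff)
    then have "card (D - {\<zero>}) \<le> card C" by (rule C(3))
    then show "card D \<le> Suc (card C)"
      using card_Diff1_le[of D \<zero>] by (cases "\<zero> \<in> D") (auto simp: card_Diff_singleton)
  qed (rule L)
  then show ?thesis using C(2) by (simp add: poset_rank_def)
qed

section \<open>The Rees product of the dual with a chain\<close>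

text \<open>The Rees product of \<open>P\<inverse>\<close> with the chain
  \<open>0 < ... < n\<close>. The rank of \<open>q\<close> in the dual is \<open>n - rk q\<close>,
  so the rank conditions become inequalities between sums, avoiding subtraction on naturals; the
  bound for the upper pair \<open>(p, m)\<close> follows by transitivity.\<close>

definition dual_rees :: "('a \<times> nat) rel" where
  "dual_rees = {((q, k), (p, m)). (p, q) \<in> P \<and> k \<le> m \<and> m + rk p \<le> k + rk q \<and> k + rk q \<le> n}"

definition dual_mobius :: "'a \<times> nat \<Rightarrow> int" where
  "dual_mobius z = mobius dual_rees (\<one>, 0) z"

lemma Partial_order_dual_rees: "Partial_order dual_rees"
  by (rule Partial_orderI)
    (auto simp: dual_rees_def intro: trans_P antisym_P refl_P FieldI1 FieldI2)

lemma finite_dual_rees: "finite dual_rees"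
proof -
  have "dual_rees \<subseteq> (Field P \<times> {..n}) \<times> (Field P \<times> {..n})"
    by (auto simp: dual_rees_def Field_def)
  then show ?thesis by (rule finite_subset) (simp add: finite_P finite_Field)
qed

lemma top_dual_rees_iff: "((\<one>, 0), (p, m)) \<in> dual_rees \<longleftrightarrow> p \<in> Field P \<and> m + rk p \<le> n"
  using le_top by (auto simp: dual_rees_def rank_top intro: FieldI1)

text \<open>The pair \<open>(\<one>, 0)\<close> lies below every element, so the interval consists
  of all elements below \<open>(p, m)\<close>.\<close>

lemma interval_dual_rees:
  "interval dual_rees (\<one>, 0) (p, m) =
    {(q, k). (p, q) \<in> P \<and> k \<le> m \<and> m + rk p \<le> k + rk q \<and> k + rk q \<le> n}"
  using top_dual_rees_iff by (auto simp: interval_def dual_rees_def intro: FieldI2)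

lemma sum_dual_mobius:
  assumes "p \<in> Field P" "m + rk p \<le> n"
  shows "sum dual_mobius (interval dual_rees (\<one>, 0) (p, m)) = (if (p, m) = (\<one>, 0) then 1 else 0)"
  using sum_mobius_interval[OF finite_dual_rees Partial_order_dual_rees, of "(\<one>, 0)" "(p, m)"] assms
  by (auto simp: dual_mobius_def[abs_def] top_dual_rees_iff)

section \<open>The Rees product of the dual with a tree\<close>

abbreviation tree_rees :: "nat \<Rightarrow> ('a \<times> nat list) rel" where
  "tree_rees t \<equiv> rees_product (P\<inverse>) (tree_poset t n)"

text \<open>By \<open>rank_dual\<close>, and because the rank of a word is its length, this is the
  condition of \<open>dual_rees\<close> with words compared by prefix and measured by
  length.\<close>

lemma tree_rees_iff: "((q, v), (p, u)) \<in> tree_rees t \<longleftrightarrow> (p, q) \<in> P \<and> prefix v u \<and> set u \<subseteq> {..<t}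
    \<and> length u + rk p \<le> length v + rk q \<and> length v + rk q \<le> n"
\<comment> \<open>The right-hand side forces \<open>length u \<le> n\<close>, so this bound can join
  the case split. It makes both words nodes of the tree, where rank is length.\<close>
proof (cases "(p, q) \<in> P \<and> prefix v u \<and> set u \<subseteq> {..<t} \<and> length u \<le> n")
  case True
  then have "p \<in> Field P" "q \<in> Field P" by (auto intro: FieldI1 FieldI2)
  note rank_dual[OF this(1)] rank_dual[OF this(2)]
  moreover have "set v \<subseteq> {..<t}" "length v \<le> n"
    using True by (auto dest: set_mono_prefix prefix_length_le)
  moreover have "(v, u) \<in> tree_poset t n" using True by (simp add: tree_poset_def)
  ultimately show ?thesis
    using True by (auto simp: rees_product_def poset_rank_tree_poset)
next
  case False
  then show ?thesis by (auto simp: rees_product_def tree_poset_def)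
qed

lemma Partial_order_tree_rees: "Partial_order (tree_rees t)"
  by (rule Partial_order_rees_product) (simp_all add: PO Partial_order_tree_poset)

lemma finite_tree_rees: "finite (tree_rees t)"
  by (rule finite_rees_product) (simp_all add: finite_P finite_tree_poset)

lemma Field_tree_rees: "Field (tree_rees t) = {(p, u). p \<in> Field P \<and> set u \<subseteq> {..<t} \<and> length u + rk p \<le> n}"
  (is "_ = ?F")
proof
  show "Field (tree_rees t) \<subseteq> ?F"
  proof
    fix x assume "x \<in> Field (tree_rees t)"
    then have "(x, x) \<in> tree_rees t" by (rule Partial_orderD(1)[OF Partial_order_tree_rees])
    then show "x \<in> ?F" by (cases x) (auto simp: tree_rees_iff intro: FieldI1)
  qed
  have "((p, u), (p, u)) \<in> tree_rees t" if "(p, u) \<in> ?F" for p u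
    using that refl_P by (simp add: tree_rees_iff)
  then show "?F \<subseteq> Field (tree_rees t)" by (auto intro: FieldI1)
qed

lemma top_tree_rees: "x \<in> Field (tree_rees t) \<Longrightarrow> ((\<one>, []), x) \<in> tree_rees t"
  by (cases x) (auto simp: Field_tree_rees tree_rees_iff rank_top le_top)

lemma interval_tree_rees:
  assumes "(p, u) \<in> Field (tree_rees t)"
  shows "interval (tree_rees t) (\<one>, []) (p, u) = {(q, v). (p, q) \<in> P \<and> prefix v u
    \<and> length u + rk p \<le> length v + rk q \<and> length v + rk q \<le> n}"
proof -
  have "((q, v), (p, u)) \<in> tree_rees t \<longleftrightarrow> ((\<one>, []), (q, v)) \<in> tree_rees t \<and> ((q, v), (p, u)) \<in> tree_rees t" for q v
    using top_tree_rees[of "(q, v)" t] by (auto intro: FieldI1)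
  then show ?thesis using assms by (auto simp: interval_def tree_rees_iff[of _ _ p u] Field_tree_rees)
qed

text \<open>Each \<open>k \<le> length u\<close> is the length of exactly one prefix of
  \<open>u\<close>, namely \<open>take k u\<close>, so replacing words by their lengths is a
  bijection between the two intervals.\<close>

lemma interval_tree_rees_sum:
  assumes "(p, u) \<in> Field (tree_rees t)"
  shows "(\<Sum>(q, v)\<in>interval (tree_rees t) (\<one>, []) (p, u). dual_mobius (q, length v))
    = sum dual_mobius (interval dual_rees (\<one>, 0) (p, length u))"
proof (rule sum.reindex_bij_witness[where j = "\<lambda>(q, v). (q, length v)"
      and i = "\<lambda>(q, k). (q, take k u)"])
  fix b assume "b \<in> interval dual_rees (\<one>, 0) (p, length u)"
  moreover obtain q k where b: "b = (q, k)" by (cases b)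
  ultimately have "(p, q) \<in> P" "k \<le> length u" "length u + rk p \<le> k + rk q" "k + rk q \<le> n"
    by (auto simp: interval_dual_rees)
  then show "(case b of (q, k) \<Rightarrow> (q, take k u)) \<in> interval (tree_rees t) (\<one>, []) (p, u)"
    by (simp add: b interval_tree_rees[OF assms] take_is_prefix min_def)
qed (auto simp: interval_dual_rees interval_tree_rees[OF assms] dest: prefix_length_le elim!: prefixE)

lemma mobius_tree_rees:
  assumes "x \<in> Field (tree_rees t)"
  shows "mobius (add_max (tree_rees t)) (Some (\<one>, [])) (Some x) = (case x of (p, u) \<Rightarrow> dual_mobius (p, length u))"
proof -
  have topF: "(\<one>, []) \<in> Field (tree_rees t)" by (simp add: Field_tree_rees top_in rank_top)
  \<comment> \<open>Uniqueness asks for interval sums at every element above the minimum, including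
    \<open>None\<close>. The value there is chosen so that the sum over the entire poset
    vanishes.\<close>
  let ?g = "\<lambda>y. case y of None \<Rightarrow> - (\<Sum>(p, u)\<in>Field (tree_rees t). dual_mobius (p, length u))
    | Some (p, u) \<Rightarrow> dual_mobius (p, length u)"
  have "mobius (add_max (tree_rees t)) (Some (\<one>, [])) (Some x) = ?g (Some x)"
  proof (rule mobius_unique_left)
    show "finite (add_max (tree_rees t))"
      by (simp add: finite_add_max finite_tree_rees)
    show "Partial_order (add_max (tree_rees t))"
      by (rule Partial_order_add_max[OF Partial_order_tree_rees])
    show "(Some (\<one>, []), Some x) \<in> add_max (tree_rees t)" using assms top_tree_rees by simp
    fix y assume y: "(Some (\<one>, []), y) \<in> add_max (tree_rees t)"
    show "sum ?g (interval (add_max (tree_rees t)) (Some (\<one>, [])) y) = (if Some (\<one>, []) = y then 1 else 0)"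
    proof (cases y)
      case None
      have "interval (add_max (tree_rees t)) (Some (\<one>, [])) None = insert None (Some ` Field (tree_rees t))"
        using topF top_tree_rees by (auto simp: interval_add_max_None intro: FieldI2)
      then show ?thesis
        by (simp add: None sum.reindex finite_tree_rees finite_Field split_def)
    next
      case (Some z)
      obtain p u where z: "z = (p, u)" by (cases z)
      have pu: "(p, u) \<in> Field (tree_rees t)" using y Some z by (auto intro: FieldI2)
      have "interval (add_max (tree_rees t)) (Some (\<one>, [])) y = Some ` interval (tree_rees t) (\<one>, []) (p, u)"
        unfolding Some z by (rule interval_add_max_Some)
      then have "sum ?g (interval (add_max (tree_rees t)) (Some (\<one>, [])) y)
        = (\<Sum>(q, v)\<in>interval (tree_rees t) (\<one>, []) (p, u). dual_mobius (q, length v))"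
        by (simp add: sum.reindex split_def)
      also have "\<dots> = (if (p, length u) = (\<one>, 0) then 1 else 0)"
        unfolding interval_tree_rees_sum[OF pu] using pu by (intro sum_dual_mobius) (auto simp: Field_tree_rees)
      finally show ?thesis by (auto simp: Some z)
    qed
  qed
  then show ?thesis by simp
qed

text \<open>The coefficient of \<open>t ^ m\<close> on the tree side, \<open>t ^ m\<close> being the
  number of words of length \<open>m\<close>.\<close>

definition level_sum :: "nat \<Rightarrow> int" where
  "level_sum m = (\<Sum>p | p \<in> Field P \<and> m + rk p \<le> n. dual_mobius (p, m))"

text \<open>The value at the adjoined maximum is minus the sum of all values below it. These depend
  on a word only through its length, so words are grouped by length.\<close>

lemma mobius_number_tree_rees: "- mobius_number (add_max (tree_rees t)) = (\<Sum>m\<le>n. int t ^ m * level_sum m)"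
proof -
  have PO': "Partial_order (add_max (tree_rees t))" by (rule Partial_order_add_max[OF Partial_order_tree_rees])
  have fin: "finite (add_max (tree_rees t))" by (simp add: finite_add_max finite_tree_rees)
  have topF: "(\<one>, []) \<in> Field (tree_rees t)" by (simp add: Field_tree_rees top_in rank_top)
  have "is_minimum (add_max (tree_rees t)) (Some (\<one>, []))"
    using topF by (auto simp: is_minimum_def top_tree_rees)
  then have z: "zero_hat (add_max (tree_rees t)) = Some (\<one>, [])" by (rule zero_hat_eqI[OF PO'])
  have o: "one_hat (add_max (tree_rees t)) = None" by (rule one_hat_eqI[OF PO' is_maximum_add_max])
  have below: "{z. (Some (\<one>, []), z) \<in> add_max (tree_rees t) \<and> (z, None) \<in> add_max (tree_rees t) \<and> z \<noteq> None}
      = Some ` Field (tree_rees t)"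
    using top_tree_rees by auto
  have "mobius (add_max (tree_rees t)) (Some (\<one>, [])) None
      = - (\<Sum>z\<in>{z. (Some (\<one>, []), z) \<in> add_max (tree_rees t) \<and> (z, None) \<in> add_max (tree_rees t) \<and> z \<noteq> None}.
            mobius (add_max (tree_rees t)) (Some (\<one>, [])) z)"
    by (subst mobius.simps) (use fin PO' topF in simp)
  then have "- mobius_number (add_max (tree_rees t))
      = (\<Sum>z\<in>Some ` Field (tree_rees t). mobius (add_max (tree_rees t)) (Some (\<one>, [])) z)"
    by (simp only: mobius_number_def z o below minus_minus)
  also have "\<dots> = (\<Sum>(p, u)\<in>Field (tree_rees t). dual_mobius (p, length u))"
    by (simp add: sum.reindex mobius_tree_rees)
  also have "Field (tree_rees t) = Sigma (Field P) (\<lambda>p. {u. set u \<subseteq> {..<t} \<and> length u + rk p \<le> n})"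
    by (auto simp: Field_tree_rees)
  also have "(\<Sum>(p, u)\<in>\<dots>. dual_mobius (p, length u))
     = (\<Sum>p\<in>Field P. \<Sum>u | set u \<subseteq> {..<t} \<and> length u + rk p \<le> n. dual_mobius (p, length u))"
  proof (rule sum.Sigma[symmetric])
    show "\<forall>p\<in>Field P. finite {u. set u \<subseteq> {..<t} \<and> length u + rk p \<le> n}"
      by (intro ballI finite_subset[OF _ finite_lists_length_le[of "{..<t}" n]]) auto
  qed (simp add: finite_P finite_Field)
  \<comment> \<open>The range of \<open>m\<close> is written as a restriction of the fixed set
    \<open>{..n}\<close> so that the sums over \<open>p\<close> and \<open>m\<close> can be
    exchanged.\<close>
  also have "\<dots> = (\<Sum>p\<in>Field P. \<Sum>m | m \<in> {..n} \<and> m + rk p \<le> n. int t ^ m * dual_mobius (p, m))"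
  proof (rule sum.cong[OF refl])
    fix p
    let ?U = "{u. set u \<subseteq> {..<t} \<and> length u + rk p \<le> n}"
    let ?M = "{m. m \<in> {..n} \<and> m + rk p \<le> n}"
    have "finite ?U"
      by (rule finite_subset[OF _ finite_lists_length_le[of "{..<t}" n]]) auto
    then have "(\<Sum>u\<in>?U. dual_mobius (p, length u)) = (\<Sum>m\<in>?M. \<Sum>u | u \<in> ?U \<and> length u = m. dual_mobius (p, length u))"
      by (intro sum.group[symmetric]) auto
    also have "\<dots> = (\<Sum>m\<in>?M. int t ^ m * dual_mobius (p, m))"
    proof (rule sum.cong[OF refl])
      fix m assume "m \<in> ?M"
      then have "{u. u \<in> ?U \<and> length u = m} = {u. set u \<subseteq> {..<t} \<and> length u = m}" by auto
      moreover have "card {u. set u \<subseteq> {..<t} \<and> length u = m} = t ^ m"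
        by (simp add: card_lists_length_eq)
      moreover have "(\<Sum>u | u \<in> ?U \<and> length u = m. dual_mobius (p, length u))
        = (\<Sum>u | u \<in> ?U \<and> length u = m. dual_mobius (p, m))" by (rule sum.cong) auto
      ultimately show "(\<Sum>u | u \<in> ?U \<and> length u = m. dual_mobius (p, length u)) = int t ^ m * dual_mobius (p, m)"
        by simp
    qed
    finally show "(\<Sum>u\<in>?U. dual_mobius (p, length u)) = (\<Sum>m\<in>?M. int t ^ m * dual_mobius (p, m))" .
  qed
  also have "\<dots> = (\<Sum>m\<le>n. \<Sum>p | p \<in> Field P \<and> m + rk p \<le> n. int t ^ m * dual_mobius (p, m))"
    by (rule sum.swap_restrict) (simp_all add: finite_P finite_Field)
  finally show ?thesis by (simp add: level_sum_def sum_distrib_left)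
qed

section \<open>The lower order ideals\<close>

abbreviation chain_rees :: "('a \<times> nat) rel" where
  "chain_rees \<equiv> rees_product (remove_zero P) (chain_poset n)"

text \<open>Ranks in \<open>remove_zero P\<close> are one below those in \<open>P\<close>, so the
  rank condition on \<open>(p, i)\<close> becomes \<open>i < rk p\<close>. For the upper pair,
  \<open>k < rk q\<close> follows from this and the last inequality.\<close>

lemma chain_rees_iff: "((p, i), (q, k)) \<in> chain_rees \<longleftrightarrow> (p, q) \<in> P \<and> p \<noteq> \<zero> \<and> i \<le> k \<and> k < n \<and> i < rk p
    \<and> k + rk p \<le> i + rk q"
proof (cases "(p, q) \<in> P \<and> p \<noteq> \<zero> \<and> i \<le> k \<and> k < n")
  case True
  then have pq: "p \<in> Field P" "q \<in> Field P" "q \<noteq> \<zero>"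
    using bottom_le antisym_P by (auto intro: FieldI1 FieldI2)
  have "Suc (poset_rank (remove_zero P) p) = rk p" "Suc (poset_rank (remove_zero P) q) = rk q"
    using True pq rank_remove_zero by auto
  moreover have "(i, k) \<in> chain_poset n" using True by (simp add: chain_poset_def)
  ultimately show ?thesis
    using True by (auto simp: rees_product_def poset_rank_chain_poset remove_zero_iff)
next
  case False
  then show ?thesis by (auto simp: rees_product_def chain_poset_def remove_zero_iff)
qed

lemma Partial_order_chain_rees: "Partial_order chain_rees"
  unfolding remove_zero_def
  by (intro Partial_order_rees_product Partial_order_Restr PO Partial_order_chain_poset)

lemma finite_chain_rees: "finite chain_rees"
proof (rule finite_rees_product)
  have "chain_poset n \<subseteq> {..<n} \<times> {..<n}" by (auto simp: chain_poset_def)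
  then show "finite (chain_poset n)" by (rule finite_subset) simp
qed (simp add: remove_zero_def finite_P)

abbreviation ideal :: "nat \<Rightarrow> ('a \<times> nat) rel" where
  "ideal j \<equiv> lower_ideal P j"

lemma ideal_def: "ideal j = Restr chain_rees (underS chain_rees (\<one>, j))"
  by (simp add: lower_ideal_def Let_def)

lemma Partial_order_ideal: "Partial_order (ideal j)"
  unfolding ideal_def by (rule Partial_order_Restr[OF Partial_order_chain_rees])

lemma finite_ideal: "finite (ideal j)"
  unfolding ideal_def by (simp add: finite_chain_rees)

lemma Field_ideal:
  assumes "j < n"
  shows "Field (ideal j) = {(p, i). p \<in> Field P \<and> p \<noteq> \<zero> \<and> i \<le> j \<and> i < rk p \<and> j + rk p \<le> i + n
    \<and> (p, i) \<noteq> (\<one>, j)}"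
proof -
  have "Field (ideal j) = underS chain_rees (\<one>, j)"
    unfolding ideal_def Field_Restr_Partial_order[OF Partial_order_chain_rees]
    by (auto simp: underS_def Field_def)
  then show ?thesis
    using assms le_top by (auto simp: underS_def chain_rees_iff rank_top intro: FieldI1)
qed

lemma ideal_iff:
  "(x, y) \<in> ideal j \<longleftrightarrow> x \<in> Field (ideal j) \<and> y \<in> Field (ideal j) \<and> (x, y) \<in> chain_rees"
  unfolding ideal_def by (auto simp: Field_Restr_Partial_order[OF Partial_order_chain_rees] intro: FieldI1 FieldI2)

text \<open>For \<open>j < n\<close>, the image of the closed ideal below \<open>(\<one>, j)\<close>
  under \<open>(p, i) \<mapsto> (p, j - i)\<close>. The strict inequality excludes
  \<open>p = \<zero>\<close>, whose rank is 0.\<close>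

definition shifted_ideal :: "nat \<Rightarrow> ('a \<times> nat) set" where
  "shifted_ideal j = {(p, m). p \<in> Field P \<and> m \<le> j \<and> j - m < rk p \<and> m + rk p \<le> n}"

text \<open>An element \<open>(p, i)\<close> below \<open>(\<one>, j)\<close> is matched with \<open>(p, j - i)\<close> in \<open>dual_rees\<close>, order reversed.
  The maximum of \<open>hat (ideal j)\<close> plays the role of \<open>(\<one>, j)\<close>; the value at its minimum
  is irrelevant.\<close>

fun dual_of_ideal :: "nat \<Rightarrow> ('a \<times> nat) option option \<Rightarrow> 'a \<times> nat" where
  "dual_of_ideal j None = (\<one>, 0)"
| "dual_of_ideal j (Some None) = (\<zero>, 0)"
| "dual_of_ideal j (Some (Some (p, i))) = (p, j - i)"

definition ideal_of_dual :: "nat \<Rightarrow> 'a \<times> nat \<Rightarrow> ('a \<times> nat) option option" where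
  "ideal_of_dual j = (\<lambda>(p, m). if (p, m) = (\<one>, 0) then None else Some (Some (p, j - m)))"

text \<open>On the ideal and the maximum of \<open>hat (ideal j)\<close>, the Moebius function up to
  that maximum is \<open>dual_mobius\<close> at the shifted element. At the adjoined minimum it is
  minus the sum of all these values.\<close>

lemma mobius_number_ideal:
  assumes j: "j < n"
  shows "mobius_number (hat (ideal j)) = - sum dual_mobius (shifted_ideal j)"
proof -
  have F: "Field (hat (ideal j)) = {None, Some None} \<union> Some ` Some ` Field (ideal j)"
    by (auto simp: hat_def)
  have o: "one_hat (hat (ideal j)) = None"
    unfolding hat_def
    by (intro one_hat_eqI is_maximum_add_max Partial_order_add_max Partial_order_add_min Partial_order_ideal)
  have z: "zero_hat (hat (ideal j)) = Some None"
    by (intro zero_hat_eqI is_minimum_hat Partial_order_hat Partial_order_ideal)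
  have neq: "\<one> \<noteq> \<zero>" using rank_top rank_bottom j by auto
  define g where "g y = (if y = Some None then - sum dual_mobius (shifted_ideal j) else dual_mobius (dual_of_ideal j y))" for y
  \<comment> \<open>The shift reverses the order, so the fixed endpoint is the maximum
    \<open>None\<close> and uniqueness from the right applies.\<close>
  have "mobius (hat (ideal j)) (Some None) None = g (Some None)"
  proof (rule mobius_unique_right)
    fix x assume x: "(x, None) \<in> hat (ideal j)"
    consider "x = None" | "x = Some None" | p i where "x = Some (Some (p, i))"
      by (metis old.prod.exhaust option.exhaust)
    then show "sum g (interval (hat (ideal j)) x None) = (if x = None then 1 else 0)"
    proof cases
      case 1
      have "dual_mobius (\<one>, 0) = 1"
        unfolding dual_mobius_def
        by (subst mobius.simps) (simp add: finite_dual_rees Partial_order_dual_rees top_dual_rees_iff top_in rank_top)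
      then show ?thesis by (simp add: 1 g_def interval_hat_top)
    next
      case 2
      let ?B = "{None} \<union> Some ` Some ` Field (ideal j)"
      have "interval (hat (ideal j)) x None = Field (hat (ideal j))"
        using is_minimum_hat[of "ideal j"] is_maximum_add_max[of "add_min (ideal j)"]
        by (auto simp: 2 interval_def is_minimum_def is_maximum_def hat_def[symmetric] intro: FieldI1)
      also have "\<dots> = insert (Some None) ?B" unfolding F by auto
      also have "sum g \<dots> = g (Some None) + sum g ?B"
        by (rule sum.insert) (auto simp: finite_ideal finite_Field)
      also have "sum g ?B = sum dual_mobius (shifted_ideal j)"
      proof (rule sum.reindex_bij_witness[where j = "dual_of_ideal j" and i = "ideal_of_dual j"])
        fix b assume b: "b \<in> shifted_ideal j"
        show "ideal_of_dual j b \<in> ?B"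
        proof (cases "b = (\<one>, 0)")
          case False
          obtain p m where "b = (p, m)" by (cases b)
          then have "ideal_of_dual j b = Some (Some (p, j - m))" "(p, j - m) \<in> Field (ideal j)"
            using b False rank_bottom by (auto simp: ideal_of_dual_def shifted_ideal_def Field_ideal[OF j])
          then show ?thesis by simp
        qed (simp add: ideal_of_dual_def)
        show "dual_of_ideal j (ideal_of_dual j b) = b" using b by (auto simp: ideal_of_dual_def shifted_ideal_def)
      next
        fix a assume a: "a \<in> ?B"
        show "dual_of_ideal j a \<in> shifted_ideal j"
          using a by (auto simp: shifted_ideal_def Field_ideal[OF j] top_in rank_top j)
        show "ideal_of_dual j (dual_of_ideal j a) = a" using a by (auto simp: ideal_of_dual_def Field_ideal[OF j])
        show "dual_mobius (dual_of_ideal j a) = g a" using a by (auto simp: g_def)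
      qed
      finally show ?thesis by (simp add: 2 g_def)
    next
      case (3 p i)
      have pi: "(p, i) \<in> Field (ideal j)" using x 3 by (auto simp: hat_def)
      then have pi': "p \<in> Field P" "p \<noteq> \<zero>" "i \<le> j" "i < rk p" "j + rk p \<le> i + n"
        "(p, i) \<noteq> (\<one>, j)" by (auto simp: Field_ideal[OF j])
      have int: "interval (hat (ideal j)) x None = insert None (Some ` Some ` {y. ((p, i), y) \<in> ideal j})"
        unfolding 3 by (rule interval_hat_Some[OF pi])
      \<comment> \<open>With \<open>None\<close> standing for \<open>(\<one>, j)\<close>, the
        elements above \<open>(p, i)\<close> shift onto the interval from \<open>(\<one>, 0)\<close>
        to \<open>(p, j - i)\<close>.\<close>
      have "sum g (interval (hat (ideal j)) x None) = sum dual_mobius (interval dual_rees (\<one>, 0) (p, j - i))"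
        unfolding int
      proof (rule sum.reindex_bij_witness[where j = "dual_of_ideal j" and i = "ideal_of_dual j"])
        fix b assume b: "b \<in> interval dual_rees (\<one>, 0) (p, j - i)"
        obtain q k where qk: "b = (q, k)" by (cases b)
        have *: "(p, q) \<in> P" "k \<le> j - i" "j - i + rk p \<le> k + rk q" "k + rk q \<le> n"
          using b by (auto simp: interval_dual_rees qk)
        have q: "q \<in> Field P" "q \<noteq> \<zero>"
          using *(1) pi' bottom_le antisym_P by (auto intro: FieldI2)
        show "ideal_of_dual j b \<in> insert None (Some ` Some ` {y. ((p, i), y) \<in> ideal j})"
        proof (cases "b = (\<one>, 0)")
          case False
          then have "ideal_of_dual j b = Some (Some (q, j - k))" "((p, i), (q, j - k)) \<in> ideal j"
            using * pi' q j by (auto simp: ideal_of_dual_def qk ideal_iff chain_rees_iff Field_ideal[OF j])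
          then show ?thesis by simp
        qed (simp add: ideal_of_dual_def)
        show "dual_of_ideal j (ideal_of_dual j b) = b" using * by (auto simp: ideal_of_dual_def qk)
      next
        fix a assume a: "a \<in> insert None (Some ` Some ` {y. ((p, i), y) \<in> ideal j})"
        show "dual_of_ideal j a \<in> interval dual_rees (\<one>, 0) (p, j - i)"
          using a pi' le_top by (auto simp: ideal_iff chain_rees_iff Field_ideal[OF j] interval_dual_rees rank_top)
        show "ideal_of_dual j (dual_of_ideal j a) = a"
          using a by (auto simp: ideal_iff ideal_of_dual_def Field_ideal[OF j])
        show "dual_mobius (dual_of_ideal j a) = g a" using a by (auto simp: g_def)
      qed
      \<comment> \<open>This is 0: as \<open>i \<le> j\<close>, equality with
        \<open>(\<one>, 0)\<close> would mean \<open>(p, i) = (\<one>, j)\<close>, which the open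
        ideal omits.\<close>
      also have "\<dots> = (if (p, j - i) = (\<one>, 0) then 1 else 0)"
        by (rule sum_dual_mobius) (use pi' in auto)
      finally show ?thesis using pi' by (auto simp: 3)
    qed
  next
    show "(Some None, None) \<in> hat (ideal j)" by (simp add: hat_def)
  qed (intro finite_hat finite_ideal Partial_order_hat Partial_order_ideal)+
  then show ?thesis by (simp add: mobius_number_def o z g_def)
qed

section \<open>Comparison of coefficients\<close>

text \<open>The values of \<open>dual_mobius\<close> sum to 0 over the interval from
  \<open>(\<one>, 0)\<close> to \<open>(\<zero>, Suc j)\<close>. Elements with second coordinate
  \<open>Suc j\<close> contribute \<open>level_sum (Suc j)\<close>; the others form
  \<open>shifted_ideal j\<close>, whose sum is minus the Moebius number of the ideal.\<close>

lemma level_sum_eq: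
  assumes "1 \<le> n"
  shows "level_sum 0 = 0"
    and "j < n \<Longrightarrow> level_sum (Suc j) = mobius_number (hat (ideal j))"
proof -
  have zero: "sum dual_mobius (interval dual_rees (\<one>, 0) (\<zero>, m)) = 0" if "m \<le> n" for m
  proof -
    have "\<one> \<noteq> \<zero>" using rank_top rank_bottom assms by auto
    then show ?thesis using sum_dual_mobius[of \<zero> m] that by (simp add: bottom_in rank_bottom)
  qed
  have level: "level_sum m = sum dual_mobius ({p \<in> Field P. m + rk p \<le> n} \<times> {m})" for m
    unfolding level_sum_def
    by (rule sum.reindex_bij_witness[where j = "\<lambda>p. (p, m)" and i = fst]) auto
  have "{p \<in> Field P. 0 + rk p \<le> n} \<times> {0} = interval dual_rees (\<one>, 0) (\<zero>, 0)"
    using bottom_le by (auto simp: interval_dual_rees rank_bottom intro: FieldI2)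
  then show "level_sum 0 = 0" using level[of 0] zero[of 0] by simp
  assume j: "j < n"
  let ?L = "{p \<in> Field P. Suc j + rk p \<le> n} \<times> {Suc j}"
  \<comment> \<open>For \<open>k \<le> j\<close>, the bound \<open>Suc j \<le> k + rk q\<close> of
    the interval reads \<open>j - k < rk q\<close>; for \<open>k = Suc j\<close> it always
    holds.\<close>
  have "interval dual_rees (\<one>, 0) (\<zero>, Suc j) = shifted_ideal j \<union> ?L"
    using bottom_le by (auto simp: interval_dual_rees rank_bottom shifted_ideal_def intro: FieldI2)
  moreover have "shifted_ideal j \<inter> ?L = {}" by (auto simp: shifted_ideal_def)
  moreover have "finite (shifted_ideal j)"
    by (rule finite_subset[of _ "Field P \<times> {..j}"]) (auto simp: shifted_ideal_def finite_P finite_Field)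
  moreover have "finite ?L" by (simp add: finite_P finite_Field)
  ultimately have "sum dual_mobius (shifted_ideal j) + sum dual_mobius ?L = 0"
    using zero[of "Suc j"] j by (simp add: sum.union_disjoint)
  then show "level_sum (Suc j) = mobius_number (hat (ideal j))"
    using mobius_number_ideal[OF j] level[of "Suc j"] by simp
qed

end

theorem theorem4p1:
  fixes P :: "'a rel" and n t :: nat
  assumes "finite (Field P)"
    and "bounded_poset P"
    and "ranked P"
    and "poset_length P = n"
    and "n \<ge> 1"
    and "t \<ge> 1"
  shows "(\<Sum>j=1..n. mobius_number (hat (lower_ideal P (j - 1))) * int t ^ j)
       = - mobius_number (add_max (rees_product (P\<inverse>) (tree_poset t n)))"
proof -
  interpret finite_ranked_poset P
    by unfold_locales (use assms finite_Field_iff in auto)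
  have "(\<Sum>j=1..n. mobius_number (hat (lower_ideal P (j - 1))) * int t ^ j)
      = (\<Sum>j=1..n. int t ^ j * level_sum j)"
  proof (rule sum.cong[OF refl])
    fix j assume "j \<in> {1..n}"
    then show "mobius_number (hat (lower_ideal P (j - 1))) * int t ^ j = int t ^ j * level_sum j"
      using level_sum_eq(2)[of "j - 1"] assms by (auto simp: Suc_le_eq)
  qed
  \<comment> \<open>The tree side also has a term for \<open>j = 0\<close>, which vanishes since
    \<open>level_sum 0 = 0\<close>.\<close>
  also have "\<dots> = (\<Sum>j\<le>n. int t ^ j * level_sum j)"
    by (rule sum.mono_neutral_left) (use level_sum_eq(1) assms in \<open>auto simp: not_le\<close>)
  finally show ?thesis using mobius_number_tree_rees[of t] assms(4) by simp
qed

end
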